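(* Let $k\in\mathbb{N}$ and let $f:\mathbb{N}^k\to\mathbb{C}$ be an arithmetic function of $k$ variables. Assume that $$\sum_{n_1,\ldots,n_k=1}^{\infty} 2^{\omega(n_1)+\cdots+\omega(n_k)}\,\frac{|(\mu^*_k\times f)(n_1,\ldots,n_k)|}{n_1\cdots n_k}<\infty .$$ Then for every $n_1,\ldots,n_k\in\mathbb{N}$, $$f(n_1,\ldots,n_k)=\sum_{q_1,\ldots,q_k=1}^{\infty}\widetilde{a}_{q_1,\ldots,q_k}\,\widetilde{c}_{q_1}(n_1)\cdots\widetilde{c}_{q_k}(n_k),$$ where $$\widetilde{a}_{q_1,\ldots,q_k}=\sum_{\substack{m_1,\ldots,m_k=1\\(m_1,q_1)=1,\ldots,(m_k,q_k)=1}}^{\infty}\frac{(\mu^*_k\times f)(m_1q_1,\ldots,m_kq_k)}{m_1q_1\cdots m_kq_k},$$ and the series over $q_1,\ldots,q_k$ is absolutely convergent.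
   Context: $\mathbb{N}=\{1,2,\ldots\}$; $(a,b)$ denotes the greatest common divisor; $\omega(n)$ is the number of distinct prime divisors of $n$. A positive integer $d$ is a unitary divisor of $n$, written $d\parallel n$, if $d\mid n$ and $(d,n/d)=1$. Put $\mu^*(n)=(-1)^{\omega(n)}$ and $\mu^*_k(n_1,\ldots,n_k)=\mu^*(n_1)\cdots\mu^*(n_k)$. The unitary convolution of $f,g:\mathbb{N}^k\to\mathbb{C}$ is $$(f\times g)(n_1,\ldots,n_k)=\sum_{d_1\parallel n_1,\ldots,d_k\parallel n_k} f(d_1,\ldots,d_k)\,g(n_1/d_1,\ldots,n_k/d_k).$$ The modified unitary Ramanujan sums $\widetilde{c}_q(n)$ ($q,n\in\mathbb{N}$) are the functions determined by $$\sum_{d\parallel q}\widetilde{c}_d(n)=\begin{cases} q,&\text{if } q\parallel n,\\ 0,&\text{otherwise;}\end{cases}$$ equivalently, $\widetilde{c}_q(n)=\sum_{d\parallel n,\ d\parallel q} d\,\mu^*(q/d)$. *)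

theory Defs
  imports "HOL-Analysis.Analysis" "HOL-Computational_Algebra.Primes"
begin

text \<open>
  Elements of the \<open>k\<close>-fold product of the positive integers are vectors of type \<open>nat ^ 'k\<close> with
  positive components, where \<open>'k\<close> is an arbitrary (hence nonempty) finite type with \<open>k\<close> elements.
  An arithmetic function of \<open>k\<close> variables is a function on \<open>nat ^ 'k\<close> of which only the values
  on \<open>pos_vecs\<close> matter.
\<close>

definition pos_vecs :: "(nat ^ 'k) set" where
  "pos_vecs = {n. \<forall>i. 0 < n $ i}"

definition unitary_dvd :: "nat \<Rightarrow> nat \<Rightarrow> bool" (infix "udvd" 50) where
  "d udvd n \<longleftrightarrow> d dvd n \<and> coprime d (n div d)"

definition omega :: "nat \<Rightarrow> nat" where
  "omega n = card (prime_factors n)"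

definition unitary_mu :: "nat \<Rightarrow> int" where
  "unitary_mu n = (- 1) ^ omega n"

definition unitary_mu_vec :: "nat ^ 'k \<Rightarrow> complex" where
  "unitary_mu_vec n = (\<Prod>i\<in>UNIV. of_int (unitary_mu (n $ i)))"

definition unitary_conv ::
    "(nat ^ 'k \<Rightarrow> complex) \<Rightarrow> (nat ^ 'k \<Rightarrow> complex) \<Rightarrow> nat ^ 'k \<Rightarrow> complex" where
  "unitary_conv f g n =
     (\<Sum>d | \<forall>i. d $ i udvd n $ i. f d * g (\<chi> i. n $ i div d $ i))"

text \<open>
  The modified unitary Ramanujan sums, with the index \<open>q\<close> as first argument. The recursion
  solves their defining identity (\<open>sum_unitary_ramanujan\<close> below) for the term \<open>d = q\<close>.
  For \<open>q > 0\<close>, the side condition \<open>d < q\<close> only excludes \<open>d = q\<close> from the unitary divisors.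
\<close>

function unitary_ramanujan :: "nat \<Rightarrow> nat \<Rightarrow> int" where
  "unitary_ramanujan q n =
     (if q udvd n then int q else 0) - (\<Sum>d | d udvd q \<and> d < q. unitary_ramanujan d n)"
  by pat_completeness auto
termination by (relation "Wellfounded.measure fst") auto

declare unitary_ramanujan.simps [simp del]

lemma sum_unitary_divisors_split:
  fixes c :: "nat \<Rightarrow> int"
  assumes "q > 0"
  shows "(\<Sum>d | d udvd q. c d) = c q + (\<Sum>d | d udvd q \<and> d < q. c d)"
proof -
  have "{d. d udvd q} = insert q {d. d udvd q \<and> d < q}"
    using assms by (auto simp: unitary_dvd_def dest: dvd_imp_le)
  then show ?thesis by simp
qed

lemma sum_unitary_ramanujan:
  assumes "q > 0"
  shows "(\<Sum>d | d udvd q. unitary_ramanujan d n) = (if q udvd n then int q else 0)"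
  using assms by (simp add: sum_unitary_divisors_split unitary_ramanujan.simps [of q])

lemma unitary_ramanujan_unique:
  fixes c :: "nat \<Rightarrow> nat \<Rightarrow> int"
  assumes c: "\<And>q n. q > 0 \<Longrightarrow> n > 0 \<Longrightarrow>
      (\<Sum>d | d udvd q. c d n) = (if q udvd n then int q else 0)"
    and "q > 0" "n > 0"
  shows "c q n = unitary_ramanujan q n"
  using \<open>q > 0\<close>
proof (induction q rule: less_induct)
  case (less q)
  have "(\<Sum>d | d udvd q \<and> d < q. c d n) = (\<Sum>d | d udvd q \<and> d < q. unitary_ramanujan d n)"
    using less by (intro sum.cong) (auto simp: unitary_dvd_def intro!: less.IH Nat.gr0I)
  then show ?case
    using c [OF less.prems \<open>n > 0\<close>] less.prems
    by (simp add: sum_unitary_divisors_split unitary_ramanujan.simps [of q])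
qed

text \<open>
  Multiple series are unordered sums over \<open>pos_vecs\<close>. As \<open>infsum\<close> is \<open>0\<close> for a family that is
  not summable, summability has to be stated separately wherever it is meant.
\<close>

definition unitary_coeff_term :: "(nat ^ 'k \<Rightarrow> complex) \<Rightarrow> nat ^ 'k \<Rightarrow> nat ^ 'k \<Rightarrow> complex" where
  "unitary_coeff_term f q m =
     unitary_conv unitary_mu_vec f (\<chi> i. m $ i * q $ i) / of_nat (\<Prod>i\<in>UNIV. m $ i * q $ i)"

definition coprime_vecs :: "nat ^ 'k \<Rightarrow> (nat ^ 'k) set" where
  "coprime_vecs q = {m \<in> pos_vecs. \<forall>i. coprime (m $ i) (q $ i)}"

definition unitary_coeff :: "(nat ^ 'k \<Rightarrow> complex) \<Rightarrow> nat ^ 'k \<Rightarrow> complex" where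
  "unitary_coeff f q = (\<Sum>\<^sub>\<infinity>m\<in>coprime_vecs q. unitary_coeff_term f q m)"

end

theory Submission
  imports Defs
begin

text \<open>
  Unitary inversion writes \<open>f n\<close> as the sum of \<open>g = \<mu>\<^sup>* \<times> f\<close> over the unitary divisors
  \<open>N\<close> of \<open>n\<close>. The defining identity of the sums \<open>c\<^sub>q(n)\<close> replaces the condition that
  \<open>N\<close> is a unitary divisor of \<open>n\<close> by the weight \<open>1/N \<Sum> c\<^sub>q(n)\<close>, summed over the unitary
  divisors \<open>q\<close> of \<open>N\<close>; the pairs \<open>(N, q)\<close> with \<open>N = m q\<close> are exactly the pairs
  \<open>(m, q)\<close> with \<open>m\<close> and \<open>q\<close> coprime, so exchanging the sums yields the expansion. The
  exchange is legitimate because \<open>c\<^sub>q(n)\<close> is bounded in \<open>q\<close> by the sum of the unitary divisors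
  of \<open>n\<close>, while \<open>N\<close> has \<open>2\<^bsup>\<omega>(N)\<^esup>\<close> unitary divisors.
\<close>

section \<open>Unitary divisors and their complements\<close>

lemma udvdD_pos: "d udvd n \<Longrightarrow> n > 0 \<Longrightarrow> d > 0"
  by (auto simp: unitary_dvd_def intro!: Nat.gr0I)

lemma udvd_mult_left_iff: "d > 0 \<Longrightarrow> d udvd d * m \<longleftrightarrow> coprime d m"
  by (simp add: unitary_dvd_def)

lemma udvd_mult_right_iff: "d > 0 \<Longrightarrow> d udvd m * d \<longleftrightarrow> coprime d m"
  by (simp add: unitary_dvd_def)

lemma udvdE:
  assumes "d udvd n"
  obtains m where "n = d * m" "coprime d m"
  using assms that [of "n div d"] by (auto simp: unitary_dvd_def)

lemma finite_udvd: "n > 0 \<Longrightarrow> finite {d. d udvd n}"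
  by (rule finite_subset [of _ "{..n}"]) (auto simp: unitary_dvd_def dvd_imp_le)

lemma udvd_quotient_pos: "b udvd n \<Longrightarrow> n > 0 \<Longrightarrow> n div b > 0"
  by (auto elim!: udvdE)

lemma udvd_quotient_eq_1_iff: "b udvd n \<Longrightarrow> n > 0 \<Longrightarrow> n div b = 1 \<longleftrightarrow> b = n"
  by (auto elim!: udvdE)

text \<open>Writing \<open>n = b * e * l\<close>, the hypotheses make the three factors pairwise
  coprime, so any of them, or a product of two, is coprime to the rest.\<close>

lemma udvd_mult_quotient:
  assumes "n > 0" "b udvd n" "e udvd n div b"
  shows "b * e udvd n" "b udvd b * e" "e udvd b * e"
proof -
  obtain m where m: "n = b * m" "coprime b m"
    using \<open>b udvd n\<close> by (rule udvdE)
  with assms have pos: "b > 0" "m > 0" by auto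
  with m assms have "e udvd m" by simp
  then obtain l where l: "m = e * l" "coprime e l" by (rule udvdE)
  with pos have "e > 0" "l > 0" by auto
  then show "b * e udvd n" "b udvd b * e" "e udvd b * e"
    using pos m l
    by (simp_all add: udvd_mult_left_iff udvd_mult_right_iff coprime_commute flip: mult.assoc)
qed

text \<open>Converse direction: with \<open>d = e * l\<close> and \<open>n = e * l * m\<close> the
  factors are again pairwise coprime, and the complement of \<open>d div e = l\<close> in
  \<open>n\<close> is \<open>e * m\<close>. Both lemmas together let \<open>(d, e)\<close> be traded
  for \<open>(d div e, e)\<close> in double sums.\<close>

lemma udvd_div_trans:
  assumes "n > 0" "d udvd n" "e udvd d"
  shows "d div e udvd n" "e udvd n div (d div e)" "d div e * e = d" "d div (d div e) = e"
proof -
  obtain m where m: "n = d * m" "coprime d m"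
    using \<open>d udvd n\<close> by (rule udvdE)
  obtain l where l: "d = e * l" "coprime e l"
    using \<open>e udvd d\<close> by (rule udvdE)
  from m l \<open>n > 0\<close> have pos: "e > 0" "l > 0" "m > 0" by auto
  have n: "n = l * (e * m)" using m l by simp
  show "d div e udvd n" "e udvd n div (d div e)" "d div e * e = d" "d div (d div e) = e"
    using pos m(2) l unfolding n
    by (simp_all add: udvd_mult_left_iff coprime_commute)
qed

section \<open>Unitary divisors as sets of primes\<close>

text \<open>A prime factor of \<open>d\<close> cannot divide the coprime cofactor, so
  \<open>d\<close> contains its full power from \<open>n\<close>.\<close>

lemma multiplicity_udvd:
  assumes "n > 0" "d udvd n" "p \<in> prime_factors d"
  shows "multiplicity p d = multiplicity p n"
proof -
  obtain m where m: "n = d * m" "coprime d m"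
    using \<open>d udvd n\<close> by (rule udvdE)
  have p: "prime p" "p dvd d"
    using assms(3) by auto
  have "\<not> p dvd m"
    using coprime_common_divisor [OF m(2) p(2)] not_prime_unit p(1) by blast
  moreover have "prime_elem p"
    using p by simp
  ultimately show ?thesis
    using m \<open>n > 0\<close> by (simp add: prime_elem_multiplicity_mult_distrib not_dvd_imp_multiplicity_0)
qed

text \<open>The exponents in a unitary divisor are forced by \<open>n\<close>, so its primes
  determine it; conversely any set of primes of \<open>n\<close> is realised by the product of their
  full powers in \<open>n\<close>.\<close>

lemma bij_betw_prime_factors_udvd:
  assumes "n > 0"
  shows "bij_betw prime_factors {d. d udvd n} (Pow (prime_factors n))"
proof (rule bij_betw_imageI)
  show "inj_on prime_factors {d. d udvd n}"
  proof (rule inj_onI)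
    fix d e assume d: "d \<in> {d. d udvd n}" and e: "e \<in> {d. d udvd n}"
      and eq: "prime_factors d = prime_factors e"
    have "d > 0" "e > 0" using d e assms by (auto intro: udvdD_pos)
    then show "d = e"
    proof (rule multiplicity_eq_nat)
      fix p :: nat assume p: "prime p"
      show "multiplicity p d = multiplicity p e"
      proof (cases "p \<in> prime_factors d")
        case True
        then show ?thesis
          using multiplicity_udvd [OF assms, of d p] multiplicity_udvd [OF assms, of e p] d e eq
          by simp
      next
        case False
        then show ?thesis
          using eq p \<open>d > 0\<close> \<open>e > 0\<close>
          by (metis in_prime_factors_iff not_dvd_imp_multiplicity_0 gr_implies_not0)
      qed
    qed
  qed
  have "prime_factors d \<subseteq> prime_factors n" if "d udvd n" for d
    using that assms by (intro dvd_prime_factors) (auto simp: unitary_dvd_def)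
  moreover have "S \<in> prime_factors ` {d. d udvd n}" if S: "S \<subseteq> prime_factors n" for S
  proof -
    define d where "d = (\<Prod>p\<in>S. p ^ multiplicity p n)"
    \<comment> \<open>The cofactor of \<open>d\<close>, built from the remaining primes and hence
      coprime to \<open>d\<close>.\<close>
    define e where "e = (\<Prod>p\<in>prime_factors n - S. p ^ multiplicity p n)"
    have fin: "finite S" using S finite_subset by blast
    have "n = (\<Prod>p\<in>prime_factors n. p ^ multiplicity p n)"
      using assms by (rule prime_factorization_nat)
    also have "\<dots> = e * d"
      unfolding d_def e_def using S by (intro prod.subset_diff) auto
    finally have n: "n = e * d" .
    have "coprime d e"
      unfolding d_def e_def
    proof (intro prod_coprime_left prod_coprime_right)
      fix p q assume "p \<in> S" "q \<in> prime_factors n - S"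
      with S have "prime p" "prime q" "p \<noteq> q" by auto
      then show "coprime (p ^ multiplicity p n) (q ^ multiplicity q n)"
        by (simp add: primes_coprime)
    qed
    moreover have "d > 0" using n assms by auto
    ultimately have "d udvd n"
      by (simp add: n udvd_mult_right_iff)
    moreover have "prime_factors d = S"
    proof (intro set_eqI iffI)
      fix p assume "p \<in> prime_factors d"
      then have "prime p" "p dvd d" by auto
      then obtain q where q: "q \<in> S" "p dvd q ^ multiplicity q n"
        using fin unfolding d_def by (auto simp: prime_dvd_prod_iff)
      then have "p dvd q" using \<open>prime p\<close> prime_dvd_power by blast
      moreover have "prime q" using q S by auto
      ultimately show "p \<in> S" using \<open>prime p\<close> primes_dvd_imp_eq q by blast
    next
      fix p assume "p \<in> S"
      with S have p: "p \<in> prime_factors n" by blast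
      \<comment> \<open>With exponent 0 the factor would be 1 and \<open>p\<close> would not divide
        it.\<close>
      then have "multiplicity p n > 0" by (simp add: prime_factors_multiplicity)
      then have "p dvd p ^ multiplicity p n" by simp
      also have "\<dots> dvd d" unfolding d_def using fin \<open>p \<in> S\<close> by (rule dvd_prodI)
      finally show "p \<in> prime_factors d"
        using p \<open>d > 0\<close> by (simp add: in_prime_factors_iff)
    qed
    ultimately show ?thesis by blast
  qed
  ultimately show "prime_factors ` {d. d udvd n} = Pow (prime_factors n)"
    by auto
qed

lemma card_udvd: "n > 0 \<Longrightarrow> card {d. d udvd n} = 2 ^ omega n"
  using bij_betw_same_card [OF bij_betw_prime_factors_udvd] by (simp add: omega_def card_Pow)

text \<open>Indexed by sets of primes of \<open>n\<close>, the alternating sum is the expansion of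
  the product of \<open>-1 + 1\<close> over these primes. It vanishes unless the product is empty,
  that is, unless \<open>n = 1\<close>.\<close>

lemma sum_unitary_mu:
  assumes "n > 0"
  shows "(\<Sum>d | d udvd n. unitary_mu d) = (if n = 1 then 1 else 0)"
proof -
  have "(\<Sum>d | d udvd n. unitary_mu d) = (\<Sum>S\<in>Pow (prime_factors n). (-1) ^ card S)"
    using sum.reindex_bij_betw [OF bij_betw_prime_factors_udvd [OF assms],
        of "\<lambda>S. (-1) ^ card S :: int"]
    by (simp add: unitary_mu_def omega_def)
  also have "\<dots> = (\<Prod>p\<in>prime_factors n. -1 + 1)"
    by (subst prod_add) simp_all
  also have "\<dots> = (if prime_factors n = {} then 1 else 0)"
    by (simp add: card_gt_0_iff)
  finally show ?thesis
    using assms by (simp add: prime_factorization_empty_iff)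
qed

section \<open>Closed form and bound for the modified unitary Ramanujan sums\<close>

text \<open>Both sides run over the factorizations \<open>n = b * e * l\<close> into pairwise
  coprime factors, with \<open>d = b * e\<close>.\<close>

lemma sum_unitary_divisors_swap:
  fixes h :: "nat \<Rightarrow> nat \<Rightarrow> 'a::comm_monoid_add"
  assumes "n > 0"
  shows "(\<Sum>d | d udvd n. \<Sum>e | e udvd d. h e (d div e)) =
         (\<Sum>b | b udvd n. \<Sum>e | e udvd n div b. h e b)"
proof -
  have "(\<Sum>d | d udvd n. \<Sum>e | e udvd d. h e (d div e)) =
      (\<Sum>(d, e)\<in>(SIGMA d:{d. d udvd n}. {e. e udvd d}). h e (d div e))"
    using assms by (intro sum.Sigma) (auto intro: finite_udvd udvdD_pos)
  also have "\<dots> = (\<Sum>(b, e)\<in>(SIGMA b:{b. b udvd n}. {e. e udvd n div b}). h e b)"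
    using assms
    by (intro sum.reindex_bij_witness
          [where i = "\<lambda>(b, e). (b * e, e)" and j = "\<lambda>(d, e). (d div e, e)"])
       (auto simp: udvd_div_trans udvd_mult_quotient udvd_quotient_pos
          dest: udvdD_pos)
  also have "\<dots> = (\<Sum>b | b udvd n. \<Sum>e | e udvd n div b. h e b)"
    using assms by (intro sum.Sigma [symmetric]) (auto intro!: finite_udvd udvd_quotient_pos)
  finally show ?thesis .
qed

text \<open>The right-hand side satisfies the defining identity: after the exchange of sums, the sum
  of \<open>unitary_mu\<close> over the unitary divisors of \<open>q div b\<close> leaves only
  \<open>b = q\<close>. Uniqueness does the rest.\<close>

lemma unitary_ramanujan_eq:
  assumes "q > 0" "n > 0"
  shows "unitary_ramanujan q n =
    (\<Sum>d | d udvd q. unitary_mu d * (if q div d udvd n then int (q div d) else 0))"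
proof (rule unitary_ramanujan_unique [symmetric])
  fix q n :: nat assume "q > 0" "n > 0"
  let ?h = "\<lambda>b. if b udvd n then int b else 0"
  have "(\<Sum>d | d udvd q. \<Sum>e | e udvd d. unitary_mu e * ?h (d div e)) =
      (\<Sum>b | b udvd q. \<Sum>e | e udvd q div b. unitary_mu e * ?h b)"
    using \<open>q > 0\<close> by (rule sum_unitary_divisors_swap)
  also have "\<dots> = (\<Sum>b | b udvd q. if b = q then ?h b else 0)"
  proof (rule sum.cong)
    fix b assume "b \<in> {b. b udvd q}"
    then obtain m where "q = b * m" by (auto elim: udvdE)
    with \<open>q > 0\<close> show "(\<Sum>e | e udvd q div b. unitary_mu e * ?h b) = (if b = q then ?h b else 0)"
      by (simp add: sum_unitary_mu flip: sum_distrib_right)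
  qed simp
  also have "\<dots> = ?h q"
    using \<open>q > 0\<close> by (subst sum.delta) (auto simp: finite_udvd unitary_dvd_def)
  finally show "(\<Sum>d | d udvd q. \<Sum>e | e udvd d. unitary_mu e * ?h (d div e)) = ?h q" .
qed (use assms in auto)

text \<open>In the closed form only common unitary divisors of \<open>q\<close> and \<open>n\<close>
  survive, each once and up to sign. The resulting bound is uniform in \<open>q\<close>.\<close>

lemma abs_unitary_ramanujan_le:
  assumes "q > 0" "n > 0"
  shows "\<bar>unitary_ramanujan q n\<bar> \<le> (\<Sum>d | d udvd n. int d)"
proof -
  let ?h = "\<lambda>b. if b udvd n then int b else 0"
  \<comment> \<open>Distinct \<open>d\<close> have distinct complements \<open>q div d\<close>, so
    no divisor of \<open>n\<close> is counted twice.\<close>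
  have inj: "inj_on ((div) q) {d. d udvd q}"
  proof (rule inj_onI)
    fix d e assume de: "d \<in> {d. d udvd q}" "e \<in> {d. d udvd q}" and eq: "q div d = q div e"
    have "a * (q div a) = q" if "a udvd q" for a
      using that by (simp add: unitary_dvd_def)
    with de eq have "d * (q div e) = q" "e * (q div e) = q"
      by (metis mem_Collect_eq)+
    with \<open>q > 0\<close> show "d = e"
      by (metis mult_cancel2 mult_0_right less_not_refl)
  qed
  have "\<bar>unitary_ramanujan q n\<bar> \<le> (\<Sum>d | d udvd q. \<bar>unitary_mu d * ?h (q div d)\<bar>)"
    unfolding unitary_ramanujan_eq [OF assms] by (rule sum_abs)
  also have "\<dots> = (\<Sum>d | d udvd q. ?h (q div d))"
    by (intro sum.cong) (auto simp: unitary_mu_def abs_mult)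
  also have "\<dots> = (\<Sum>b\<in>(div) q ` {d. d udvd q}. ?h b)"
    using inj by (simp add: sum.reindex)
  \<comment> \<open>Dropping the zero terms turns the index set into a subset of the unitary
    divisors of \<open>n\<close>, which may then be enlarged to all of them.\<close>
  also have "\<dots> = (\<Sum>b | b \<in> (div) q ` {d. d udvd q} \<and> b udvd n. int b)"
    using \<open>q > 0\<close> by (intro sum.mono_neutral_cong_right) (auto simp: finite_udvd)
  also have "\<dots> \<le> (\<Sum>b | b udvd n. int b)"
    using \<open>n > 0\<close> by (intro sum_mono2) (auto simp: finite_udvd)
  finally show ?thesis .
qed

section \<open>Componentwise unitary divisors and inversion in several variables\<close>

abbreviation unitary_divisors_vec :: "nat ^ 'k \<Rightarrow> (nat ^ 'k) set" where
  "unitary_divisors_vec n \<equiv> {d. \<forall>i. d $ i udvd n $ i}"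

text \<open>Carries counting, finiteness and the distributive law from extensional function spaces
  over to vectors; over \<open>UNIV\<close> extensionality is no restriction.\<close>

lemma bij_betw_vec_lambda_PiE:
  "bij_betw vec_lambda (PiE UNIV B) {v. \<forall>i. v $ i \<in> B i}"
  by (rule bij_betw_byWitness [where f' = vec_nth]) auto

lemma prod_sum_vec:
  fixes F :: "'k::finite \<Rightarrow> 'b \<Rightarrow> 'c::comm_semiring_1"
  assumes "\<And>i. finite (B i)"
  shows "(\<Prod>i\<in>UNIV. \<Sum>x\<in>B i. F i x) = (\<Sum>v | \<forall>i. v $ i \<in> B i. \<Prod>i\<in>UNIV. F i (v $ i))"
  using assms
  by (simp add: prod_sum_PiE flip: sum.reindex_bij_betw [OF bij_betw_vec_lambda_PiE])

lemma finite_unitary_divisors_vec: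
  assumes "n \<in> pos_vecs"
  shows "finite (unitary_divisors_vec n)"
  using bij_betw_finite [OF bij_betw_vec_lambda_PiE, of "\<lambda>i. {d. d udvd n $ i}"] assms
  by (auto simp: pos_vecs_def intro!: finite_PiE finite_udvd)

lemma card_unitary_divisors_vec:
  assumes "n \<in> pos_vecs"
  shows "card (unitary_divisors_vec n) = 2 ^ (\<Sum>i\<in>UNIV. omega (n $ i))"
  using bij_betw_same_card [OF bij_betw_vec_lambda_PiE, of "\<lambda>i. {d. d udvd n $ i}"] assms
  by (simp add: pos_vecs_def card_PiE card_udvd power_sum)

lemma sum_unitary_mu_vec:
  assumes "n \<in> pos_vecs"
  shows "(\<Sum>d\<in>unitary_divisors_vec n. unitary_mu_vec d) = (if n = (\<chi> i. 1) then 1 else 0)"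
proof -
  have "(\<Sum>d\<in>unitary_divisors_vec n. unitary_mu_vec d) =
      (\<Prod>i\<in>UNIV. \<Sum>d | d udvd n $ i. of_int (unitary_mu d) :: complex)"
    using assms by (subst prod_sum_vec) (auto simp: unitary_mu_vec_def pos_vecs_def finite_udvd)
  also have "\<dots> = (\<Prod>i\<in>UNIV. if n $ i = 1 then 1 else 0)"
    using assms by (intro prod.cong) (auto simp: pos_vecs_def sum_unitary_mu simp flip: of_int_sum)
  also have "\<dots> = (if n = (\<chi> i. 1) then 1 else 0)"
    by (auto simp: vec_eq_iff)
  finally show ?thesis .
qed

lemma unitary_divisors_vec_pos: "d \<in> unitary_divisors_vec n \<Longrightarrow> n \<in> pos_vecs \<Longrightarrow> d \<in> pos_vecs"
  by (auto simp: pos_vecs_def intro: udvdD_pos)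

lemma sum_unitary_ramanujan_vec:
  assumes "q \<in> pos_vecs"
  shows "(\<Sum>d\<in>unitary_divisors_vec q. \<Prod>i\<in>UNIV. of_int (unitary_ramanujan (d $ i) (n $ i))) =
    (if q \<in> unitary_divisors_vec n then of_nat (\<Prod>i\<in>UNIV. q $ i) else 0 :: complex)"
proof -
  have "(\<Sum>d\<in>unitary_divisors_vec q. \<Prod>i\<in>UNIV. of_int (unitary_ramanujan (d $ i) (n $ i))) =
      (\<Prod>i\<in>UNIV. \<Sum>d | d udvd q $ i. of_int (unitary_ramanujan d (n $ i)) :: complex)"
    using assms by (subst prod_sum_vec) (auto simp: pos_vecs_def finite_udvd)
  also have "\<dots> = (\<Prod>i\<in>UNIV. if q $ i udvd n $ i then of_nat (q $ i) else 0)"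
    using assms
    by (intro prod.cong) (auto simp: pos_vecs_def sum_unitary_ramanujan simp flip: of_int_sum)
  also have "\<dots> = (if q \<in> unitary_divisors_vec n then of_nat (\<Prod>i\<in>UNIV. q $ i) else 0)"
    by (auto intro: prod_zero)
  finally show ?thesis .
qed

text \<open>Unitary inversion: with \<open>b\<close> the componentwise quotient of \<open>d\<close>
  by \<open>e\<close>, the sum of \<open>unitary_mu_vec e\<close> for fixed \<open>b\<close>
  vanishes unless the quotient of \<open>n\<close> by \<open>b\<close> is the all-ones
  vector.\<close>

lemma sum_unitary_conv_mu:
  assumes n: "n \<in> pos_vecs"
  shows "(\<Sum>d\<in>unitary_divisors_vec n. unitary_conv unitary_mu_vec f d) = f n"
proof -
  let ?D = unitary_divisors_vec
  let ?q = "\<lambda>n b. \<chi> i. n $ i div b $ i"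
  have pos: "n $ i > 0" for i using n by (simp add: pos_vecs_def)
  have quot: "?q n b \<in> pos_vecs" if "b \<in> ?D n" for b
    using that pos by (simp add: pos_vecs_def udvd_quotient_pos)
  have "(\<Sum>d\<in>?D n. unitary_conv unitary_mu_vec f d) =
      (\<Sum>(d, e)\<in>Sigma (?D n) ?D. unitary_mu_vec e * f (?q d e))"
    unfolding unitary_conv_def using n
    by (intro sum.Sigma ballI finite_unitary_divisors_vec) (simp_all add: unitary_divisors_vec_pos)
  also have "\<dots> = (\<Sum>(b, e)\<in>(SIGMA b:?D n. ?D (?q n b)). unitary_mu_vec e * f b)"
  proof (intro sum.reindex_bij_witness
      [where i = "\<lambda>(b, e). (\<chi> i. b $ i * e $ i, e)" and j = "\<lambda>(d, e). (?q d e, e)"])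
    fix x assume x: "x \<in> Sigma (?D n) ?D"
    then obtain d e where de: "x = (d, e)" "\<And>i. d $ i udvd n $ i" "\<And>i. e $ i udvd d $ i"
      by auto
    show "(case case x of (d, e) \<Rightarrow> (?q d e, e) of (b, e) \<Rightarrow> (\<chi> i. b $ i * e $ i, e)) = x"
      and "(case x of (d, e) \<Rightarrow> (?q d e, e)) \<in> (SIGMA b:?D n. ?D (?q n b))"
      and "(case case x of (d, e) \<Rightarrow> (?q d e, e) of (b, e) \<Rightarrow> unitary_mu_vec e * f b) =
        (case x of (d, e) \<Rightarrow> unitary_mu_vec e * f (?q d e))"
      using de udvd_div_trans [OF pos de(2,3)] by (simp_all add: vec_eq_iff)
  next
    fix x assume x: "x \<in> (SIGMA b:?D n. ?D (?q n b))"
    then obtain b e where be: "x = (b, e)" "\<And>i. b $ i udvd n $ i" "\<And>i. e $ i udvd n $ i div b $ i"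
      by auto
    \<comment> \<open>Positivity allows \<open>e $ i\<close> to be cancelled when \<open>b\<close>
      is recovered from the product \<open>b $ i * e $ i\<close>.\<close>
    have "e $ i > 0" for i
      using be pos by (blast intro: udvdD_pos udvd_quotient_pos)
    then show "(case case x of (b, e) \<Rightarrow> (\<chi> i. b $ i * e $ i, e) of (d, e) \<Rightarrow> (?q d e, e)) = x"
      and "(case x of (b, e) \<Rightarrow> (\<chi> i. b $ i * e $ i, e)) \<in> Sigma (?D n) ?D"
      using be udvd_mult_quotient [OF pos be(2,3)] by (simp_all add: vec_eq_iff)
  qed
  also have "\<dots> = (\<Sum>b\<in>?D n. \<Sum>e\<in>?D (?q n b). unitary_mu_vec e * f b)"
    using n quot by (intro sum.Sigma [symmetric] ballI finite_unitary_divisors_vec)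
  also have "\<dots> = (\<Sum>b\<in>?D n. if b = n then f b else 0)"
  proof (rule sum.cong)
    fix b assume b: "b \<in> ?D n"
    have "?q n b = (\<chi> i. 1) \<longleftrightarrow> b = n"
      using b udvd_quotient_eq_1_iff [OF _ pos] by (simp add: vec_eq_iff)
    then show "(\<Sum>e\<in>?D (?q n b). unitary_mu_vec e * f b) = (if b = n then f b else 0)"
      using sum_unitary_mu_vec [OF quot [OF b]] by (simp flip: sum_distrib_right)
  qed simp
  also have "\<dots> = f n"
    using n pos finite_unitary_divisors_vec [OF n] by (subst sum.delta) (auto simp: unitary_dvd_def)
  finally show ?thesis .
qed

section \<open>Regrouping and exchange of the series\<close>

text \<open>For positive \<open>q $ i\<close>, coprimality of \<open>m $ i\<close> and
  \<open>q $ i\<close> says precisely that \<open>q $ i\<close> is a unitary divisor of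
  \<open>m $ i * q $ i\<close>; division by \<open>q\<close> gives the inverse map.\<close>

lemma bij_betw_coprime_vecs_unitary_divisors_vec:
  "bij_betw (\<lambda>(q, m). (\<chi> i. m $ i * q $ i, q))
     (Sigma pos_vecs coprime_vecs) (Sigma pos_vecs unitary_divisors_vec)"
proof (rule bij_betw_byWitness [where f' = "\<lambda>(n, q). (q, \<chi> i. n $ i div q $ i)"])
  show "\<forall>x\<in>Sigma pos_vecs coprime_vecs.
      (case case x of (q, m) \<Rightarrow> (\<chi> i. m $ i * q $ i, q) of (n, q) \<Rightarrow> (q, \<chi> i. n $ i div q $ i)) = x"
    by (auto simp: vec_eq_iff pos_vecs_def)
  show "\<forall>x\<in>Sigma pos_vecs unitary_divisors_vec.
      (case case x of (n, q) \<Rightarrow> (q, \<chi> i. n $ i div q $ i) of (q, m) \<Rightarrow> (\<chi> i. m $ i * q $ i, q)) = x"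
    by (auto simp: vec_eq_iff unitary_dvd_def)
  show "(\<lambda>(q, m). (\<chi> i. m $ i * q $ i, q)) ` Sigma pos_vecs coprime_vecs
      \<subseteq> Sigma pos_vecs unitary_divisors_vec"
    by (auto simp: pos_vecs_def coprime_vecs_def udvd_mult_right_iff coprime_commute)
  show "(\<lambda>(n, q). (q, \<chi> i. n $ i div q $ i)) ` Sigma pos_vecs unitary_divisors_vec
      \<subseteq> Sigma pos_vecs coprime_vecs"
    by (auto simp: pos_vecs_def coprime_vecs_def udvd_quotient_pos intro: udvdD_pos)
       (auto simp: unitary_dvd_def coprime_commute)
qed

theorem theorem2:
  fixes f :: "nat ^ 'k \<Rightarrow> complex"
  assumes "(\<lambda>n. 2 ^ (\<Sum>i\<in>UNIV. omega (n $ i)) * norm (unitary_conv unitary_mu_vec f n)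
              / real (\<Prod>i\<in>UNIV. n $ i)) summable_on pos_vecs"
  shows "(\<forall>q\<in>pos_vecs. (\<lambda>m. norm (unitary_coeff_term f q m)) summable_on coprime_vecs q) \<and>
         (\<forall>n\<in>pos_vecs.
            (\<lambda>q. norm (unitary_coeff f q * (\<Prod>i\<in>UNIV. of_int (unitary_ramanujan (q $ i) (n $ i)))))
              summable_on pos_vecs \<and>
            f n = (\<Sum>\<^sub>\<infinity>q\<in>pos_vecs. unitary_coeff f q *
                     (\<Prod>i\<in>UNIV. of_int (unitary_ramanujan (q $ i) (n $ i)))))"
proof (intro conjI ballI)
  let ?D = unitary_divisors_vec
  \<comment> \<open>A coefficient term depends on \<open>m\<close> and \<open>q\<close> only through
    their componentwise product \<open>N\<close>, and equals \<open>G N\<close>.\<close>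
  define G where "G N = unitary_conv unitary_mu_vec f N / of_nat (\<Prod>i\<in>UNIV. N $ i)" for N
  have norm_G: "2 ^ (\<Sum>i\<in>UNIV. omega (N $ i)) * norm (unitary_conv unitary_mu_vec f N)
      / real (\<Prod>i\<in>UNIV. N $ i) = 2 ^ (\<Sum>i\<in>UNIV. omega (N $ i)) * norm (G N)" for N
    by (simp add: G_def norm_divide norm_mult flip: of_nat_prod)
  have summable: "(\<lambda>N. 2 ^ (\<Sum>i\<in>UNIV. omega (N $ i)) * norm (G N)) summable_on pos_vecs"
    using assms unfolding norm_G .
  have abs_G: "(\<lambda>N. norm (G N)) summable_on pos_vecs"
  proof (rule Infinite_Sum.abs_summable_on_comparison_test' [OF summable])
    fix N :: "nat ^ 'k"
    show "norm (G N) \<le> 2 ^ (\<Sum>i\<in>UNIV. omega (N $ i)) * norm (G N)"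
      by (simp add: mult_le_cancel_right1)
  qed
  have term_eq: "unitary_coeff_term f q m = G (\<chi> i. m $ i * q $ i)" for q m
    by (simp add: unitary_coeff_term_def G_def)

  show "(\<lambda>m. norm (unitary_coeff_term f q m)) summable_on coprime_vecs q" if q: "q \<in> pos_vecs" for q
  proof -
    let ?mult = "\<lambda>m. \<chi> i. m $ i * q $ i"
    have nz: "q $ i \<noteq> 0" for i
      using q by (simp add: pos_vecs_def)
    \<comment> \<open>As no component of \<open>q\<close> is 0, the terms of one coefficient form a
      subfamily of \<open>G\<close> without repetition.\<close>
    have "inj_on ?mult (coprime_vecs q)"
      by (intro inj_onI) (simp add: vec_eq_iff nz)
    moreover have "(\<lambda>N. norm (G N)) summable_on ?mult ` coprime_vecs q"
      by (rule summable_on_subset_banach [OF abs_G])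
         (use q in \<open>auto simp: pos_vecs_def coprime_vecs_def\<close>)
    ultimately show ?thesis
      by (simp add: summable_on_reindex term_eq o_def)
  qed

  fix n :: "nat ^ 'k" assume n: "n \<in> pos_vecs"
  define C where "C q = (\<Prod>i\<in>UNIV. of_int (unitary_ramanujan (q $ i) (n $ i)) :: complex)" for q
  \<comment> \<open>A bound for all \<open>C q\<close> that depends on \<open>n\<close>
    alone.\<close>
  define K where "K = (\<Prod>i\<in>UNIV. real_of_int (\<Sum>d | d udvd n $ i. int d))"
  have norm_C: "norm (C q) \<le> K" if "q \<in> pos_vecs" for q
    unfolding C_def K_def prod_norm [symmetric]
    using that n
    by (intro prod_mono) (auto simp: pos_vecs_def simp del: of_int_sum simp flip: of_int_abs
          intro!: abs_unitary_ramanujan_le)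
  let ?F = "\<lambda>(N, q). G N * C q"
  \<comment> \<open>For fixed \<open>N\<close> there are
    \<open>2 ^ (\<Sum>i\<in>UNIV. omega (N $ i))\<close> indices \<open>q\<close>, each contributing
    at most \<open>norm (G N) * K\<close>; this is where the weight in the hypothesis is
    spent.\<close>
  have abs_F: "(\<lambda>x. norm (?F x)) summable_on Sigma pos_vecs ?D"
    unfolding Infinite_Sum.abs_summable_on_Sigma_iff
  proof (intro conjI ballI)
    fix N :: "nat ^ 'k" assume "N \<in> pos_vecs"
    then show "(\<lambda>q. norm (?F (N, q))) summable_on ?D N"
      by (simp add: finite_unitary_divisors_vec summable_on_finite)
  next
    show "(\<lambda>N. norm (\<Sum>\<^sub>\<infinity>q\<in>?D N. norm (?F (N, q)))) summable_on pos_vecs"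
    proof (rule Infinite_Sum.abs_summable_on_comparison_test' [OF summable_on_cmult_right [OF summable, of K]])
      fix N :: "nat ^ 'k" assume N: "N \<in> pos_vecs"
      have "(\<Sum>q\<in>?D N. norm (G N * C q)) \<le> (\<Sum>q\<in>?D N. norm (G N) * K)"
        using N by (intro sum_mono)
          (simp add: norm_mult mult_left_mono norm_C unitary_divisors_vec_pos [OF _ N])
      also have "\<dots> = K * (2 ^ (\<Sum>i\<in>UNIV. omega (N $ i)) * norm (G N))"
        using N by (simp add: card_unitary_divisors_vec)
      finally show "norm (\<Sum>\<^sub>\<infinity>q\<in>?D N. norm (?F (N, q)))
          \<le> K * (2 ^ (\<Sum>i\<in>UNIV. omega (N $ i)) * norm (G N))"
        using N by (simp add: finite_unitary_divisors_vec sum_nonneg)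
    qed
  qed
  let ?T = "\<lambda>(q, m). unitary_coeff_term f q m * C q"
  have T: "?T = (\<lambda>x. ?F (case x of (q, m) \<Rightarrow> (\<chi> i. m $ i * q $ i, q)))"
    by (auto simp: term_eq)
  note bij = bij_betw_coprime_vecs_unitary_divisors_vec [where ?'a = 'k]
  have abs_T: "(\<lambda>x. norm (?T x)) summable_on Sigma pos_vecs coprime_vecs"
    unfolding T using summable_on_reindex_bij_betw [OF bij, of "\<lambda>x. norm (?F x)"] abs_F by simp
  \<comment> \<open>Summability need not be checked here: a zero factor \<open>C q\<close> makes
    both sides 0, and a nonzero one preserves summability in both directions, with default value 0
    if it fails.\<close>
  have inner: "(\<Sum>\<^sub>\<infinity>m\<in>coprime_vecs q. ?T (q, m)) = unitary_coeff f q * C q" for q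
    by (simp add: unitary_coeff_def infsum_cmult_left')

  \<comment> \<open>Grouping an absolutely summable double family by \<open>q\<close> keeps absolute
    summability, since the norm of each inner sum is at most the sum of the norms.\<close>
  have "(\<lambda>q. norm (unitary_coeff f q * C q)) summable_on pos_vecs"
  proof (rule Infinite_Sum.abs_summable_on_comparison_test)
    show "(\<lambda>q. norm (\<Sum>\<^sub>\<infinity>m\<in>coprime_vecs q. norm (?T (q, m)))) summable_on pos_vecs"
      using abs_T unfolding Infinite_Sum.abs_summable_on_Sigma_iff by blast
    fix q :: "nat ^ 'k" assume "q \<in> pos_vecs"
    then have "(\<lambda>m. norm (?T (q, m))) summable_on coprime_vecs q"
      using abs_T unfolding Infinite_Sum.abs_summable_on_Sigma_iff by blast
    then show "norm (unitary_coeff f q * C q) \<le> norm (\<Sum>\<^sub>\<infinity>m\<in>coprime_vecs q. norm (?T (q, m)))"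
      using norm_infsum_bound unfolding inner [symmetric] by fastforce
  qed
  then show "(\<lambda>q. norm (unitary_coeff f q *
      (\<Prod>i\<in>UNIV. of_int (unitary_ramanujan (q $ i) (n $ i))))) summable_on pos_vecs"
    by (simp add: C_def)

  have "f n = (\<Sum>N\<in>?D n. unitary_conv unitary_mu_vec f N)"
    using sum_unitary_conv_mu [OF n] by simp
  also have "\<dots> = (\<Sum>\<^sub>\<infinity>N\<in>?D n. unitary_conv unitary_mu_vec f N)"
    using n by (simp add: finite_unitary_divisors_vec)
  \<comment> \<open>The finite sum is extended to all \<open>N\<close>: the inner sum over
    \<open>q\<close> is \<open>G N\<close> times the product of the components of \<open>N\<close>
    if \<open>N\<close> divides \<open>n\<close> unitarily, and 0 otherwise.\<close>
  also have "\<dots> = (\<Sum>\<^sub>\<infinity>N\<in>pos_vecs. \<Sum>\<^sub>\<infinity>q\<in>?D N. G N * C q)"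
  proof (rule infsum_cong_neutral)
    fix N
    have inner: "(\<Sum>\<^sub>\<infinity>q\<in>?D N. G N * C q) =
        (if N \<in> ?D n then unitary_conv unitary_mu_vec f N else 0)" if "N \<in> pos_vecs"
    proof -
      have "(\<Prod>i\<in>UNIV. of_nat (N $ i)) \<noteq> (0 :: complex)"
        using that by (simp add: pos_vecs_def)
      moreover have "(\<Sum>\<^sub>\<infinity>q\<in>?D N. G N * C q) = G N * (\<Sum>q\<in>?D N. C q)"
        using that by (simp add: finite_unitary_divisors_vec sum_distrib_left)
      ultimately show ?thesis
        using sum_unitary_ramanujan_vec [OF that, of n] by (simp add: C_def G_def)
    qed
    show "(\<Sum>\<^sub>\<infinity>q\<in>?D N. G N * C q) = 0" if "N \<in> pos_vecs - ?D n"
      using that inner by auto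
    show "unitary_conv unitary_mu_vec f N = 0" if "N \<in> ?D n - pos_vecs"
      using that unitary_divisors_vec_pos n by blast
    show "unitary_conv unitary_mu_vec f N = (\<Sum>\<^sub>\<infinity>q\<in>?D N. G N * C q)" if "N \<in> ?D n \<inter> pos_vecs"
      using that inner by auto
  qed
  also have "\<dots> = infsum ?F (Sigma pos_vecs ?D)"
    by (rule infsum_Sigma'_banach [OF abs_summable_summable [OF abs_F]])
  \<comment> \<open>The substitution \<open>N = m * q\<close> (componentwise) makes \<open>q\<close>
    available as the outer summation variable.\<close>
  also have "\<dots> = infsum ?T (Sigma pos_vecs coprime_vecs)"
    unfolding T by (rule infsum_reindex_bij_betw [OF bij, symmetric])
  also have "\<dots> = (\<Sum>\<^sub>\<infinity>q\<in>pos_vecs. \<Sum>\<^sub>\<infinity>m\<in>coprime_vecs q. unitary_coeff_term f q m * C q)"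
    by (rule infsum_Sigma'_banach [OF abs_summable_summable [OF abs_T], symmetric])
  also have "\<dots> = (\<Sum>\<^sub>\<infinity>q\<in>pos_vecs. unitary_coeff f q * C q)"
    using inner by simp
  finally show "f n = (\<Sum>\<^sub>\<infinity>q\<in>pos_vecs. unitary_coeff f q *
      (\<Prod>i\<in>UNIV. of_int (unitary_ramanujan (q $ i) (n $ i))))"
    by (simp add: C_def)
qed

end
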